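(* Let $K$ be a triangulated polygon in $\mathbb{R}^2$, homeomorphic to a disc $D$, with possible identifications of simplices on the boundary $K_0$ of $K$. Then $$\chi(K) = \chi(K_0) + 1,$$ where both sides are computed taking the identifications of simplices of $K_0$ into account.
   Context: The polygon $K$ is given with a finite triangulation, which induces a triangulation (vertices and edges) of its boundary. The edges and vertices of the boundary are named and oriented, and boundary edges with the same name are identified with one another respecting orientation, with the induced (and possibly further) identifications of boundary vertices with boundary vertices; no identification may occur at all. $K_0$ denotes the boundary of $K$ with the given identifications. No identification is made among simplices that are not in the boundary. $\chi(K) = n_0^K - n_1^K + n_2^K$, where $n_0^K, n_1^K, n_2^K$ are respectively the numbers of vertices, edges and triangles of the triangulation of $K$, and $\chi(K_0) = n_0^{K_0} - n_1^{K_0}$, where $n_0^{K_0}, n_1^{K_0}$ are the numbers of vertices and edges of $K_0$. In all of these counts, boundary simplices that are identified with one another are counted as a single simplex. *)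

theory Defs
  imports "HOL-Analysis.Analysis"
begin

text \<open>A finite union of linear simplices in the plane that is homeomorphic to a closed disc is
  automatically a polygonal region, so no separate polygon condition is imposed. A simplicial
  complex in the sense of the library is finite and closed under faces; it may contain the empty
  simplex (of dimension \<open>-1\<close>), which is never counted below.\<close>

definition triangulated_polygon :: "(real^2) set \<Rightarrow> (real^2) set set \<Rightarrow> bool" where
  "triangulated_polygon K T \<longleftrightarrow>
     simplicial_complex T \<and> \<Union>T = K \<and> K homeomorphic cball (0::real^2) 1"

definition simplices :: "int \<Rightarrow> (real^2) set set \<Rightarrow> (real^2) set set" where
  "simplices n T = {S \<in> T. n simplex S}"

definition boundary_complex :: "(real^2) set \<Rightarrow> (real^2) set set \<Rightarrow> (real^2) set set" where
  "boundary_complex K T = {S \<in> T. S \<subseteq> frontier K}"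

text \<open>Two boundary vertices (boundary edges) are identified iff they have the same name. The
  functions \<open>tail\<close> and \<open>head\<close> orient the boundary edges; equally named edges are glued tail to tail
  and head to head, which forces the corresponding equalities between vertex names. Vertex names
  may coincide beyond what is forced in this way. The values of the four functions away from the
  boundary simplices are irrelevant.\<close>

definition boundary_labelling ::
  "(real^2) set \<Rightarrow> (real^2) set set \<Rightarrow> (real^2 \<Rightarrow> 'v) \<Rightarrow> ((real^2) set \<Rightarrow> 'e) \<Rightarrow>
   ((real^2) set \<Rightarrow> real^2) \<Rightarrow> ((real^2) set \<Rightarrow> real^2) \<Rightarrow> bool" where
  "boundary_labelling K T vname ename tail head \<longleftrightarrow>
     (\<forall>e \<in> simplices 1 (boundary_complex K T). e = closed_segment (tail e) (head e)) \<and>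
     (\<forall>e \<in> simplices 1 (boundary_complex K T). \<forall>e' \<in> simplices 1 (boundary_complex K T).
        ename e = ename e' \<longrightarrow>
        vname (tail e) = vname (tail e') \<and> vname (head e) = vname (head e'))"

definition identified ::
  "(real^2) set \<Rightarrow> (real^2) set set \<Rightarrow> (real^2 \<Rightarrow> 'v) \<Rightarrow> ((real^2) set \<Rightarrow> 'e) \<Rightarrow>
   ((real^2) set \<times> (real^2) set) set" where
  "identified K T vname ename =
     Id_on T \<union>
     {({v}, {w}) | v w. {v} \<in> boundary_complex K T \<and> {w} \<in> boundary_complex K T \<and>
                        vname v = vname w} \<union>
     {(e, e') | e e'. e \<in> simplices 1 (boundary_complex K T) \<and>
                      e' \<in> simplices 1 (boundary_complex K T) \<and> ename e = ename e'}"

lemma equiv_identified: "equiv T (identified K T vname ename)"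
proof -
  have "\<not> 1 simplex {v}" for v :: "real^2"
    using aff_dim_simplex[of 1 "{v}"] by auto
  then show ?thesis
    by (intro equivI refl_onI symI transI)
       (auto simp: identified_def boundary_complex_def simplices_def)
qed

definition num_simplices ::
  "int \<Rightarrow> (real^2) set set \<Rightarrow> ((real^2) set \<times> (real^2) set) set \<Rightarrow> nat" where
  "num_simplices n C R = card (simplices n C // R)"

definition euler_char_polygon ::
  "(real^2) set \<Rightarrow> (real^2) set set \<Rightarrow> (real^2 \<Rightarrow> 'v) \<Rightarrow> ((real^2) set \<Rightarrow> 'e) \<Rightarrow> int" where
  "euler_char_polygon K T vname ename =
     (let R = identified K T vname ename in
      int (num_simplices 0 T R) - int (num_simplices 1 T R) + int (num_simplices 2 T R))"

definition euler_char_boundary ::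
  "(real^2) set \<Rightarrow> (real^2) set set \<Rightarrow> (real^2 \<Rightarrow> 'v) \<Rightarrow> ((real^2) set \<Rightarrow> 'e) \<Rightarrow> int" where
  "euler_char_boundary K T vname ename =
     (let R = identified K T vname ename; T0 = boundary_complex K T in
      int (num_simplices 0 T0 R) - int (num_simplices 1 T0 R))"

end

theory Submission
  imports Defs
begin

text \<open>For the union \<open>X\<close> of any simplicial complex in the plane, vertices minus edges plus triangles
  equals the number of components of \<open>X\<close> minus the number of components of \<open>- X\<close> plus one; this is
  shown by adding one simplex at a time, the edge case resting on Janiszewski's theorem and its
  dual. A disc and its complement are connected, which gives \<open>1 - 1 + 1 = 1\<close>; the frontier of the
  disc is connected and its complement has two components, which gives \<open>1 - 2 + 1 = 0\<close>. Hence the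
  simplices off the boundary contribute \<open>1\<close>, and these are unaffected by the identifications.\<close>

text \<open>Peeling triangles off a disc one at a time requires an order in which the remainder
  stays a disc. Arbitrary complexes need no such order: a simplex of the largest dimension present
  is taken away, so it is a proper face of nothing and meets the rest exactly in its relative
  frontier. The price is that the components of the union and of its complement must be tracked
  together, because the effect of an edge on either number alone depends on whether its ends are
  already joined. The formula applies to the frontier only if the frontier is the union of a
  subcomplex. The simplices contained in \<open>frontier K\<close> could fail to cover it if an edge
  ran partly in the frontier and partly in the interior; excluding this takes the same tube around a
  segment as the edge case. The inductive claim includes finiteness of both sets of components,
  since \<open>card\<close> of an infinite set is \<open>0\<close> and the count would say
  nothing.\<close>

section \<open>Components of a closed set after a connected closed set is added\<close>

lemma components_closed_unique:
  fixes S :: "'a::topological_space set"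
  assumes "finite A" "pairwise disjnt A" "\<Union>A = S"
    and A: "\<And>X. X \<in> A \<Longrightarrow> closed X \<and> connected X \<and> X \<noteq> {}"
  shows "components S = A"
proof -
  have comp: "X \<in> components S" if "X \<in> A" for X
  proof -
    have "X \<noteq> {}" using A that by blast
    then obtain x where x: "x \<in> X" by blast
    \<comment> \<open>Finiteness of \<open>A\<close> makes the union of the other pieces closed, so
      a connected set through \<open>x\<close> cannot leave \<open>X\<close>.\<close>
    have *: "D \<subseteq> X" if D: "connected D" "D \<subseteq> S" "x \<in> D" for D
    proof -
      have cl: "closed X" "closed (\<Union>(A - {X}))"
        using A \<open>X \<in> A\<close> \<open>finite A\<close> by auto
      have dis: "X \<inter> \<Union>(A - {X}) = {}"
        using assms(2) \<open>X \<in> A\<close> by (fastforce simp: pairwise_def disjnt_def)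
      have "D \<subseteq> X \<union> \<Union>(A - {X})"
        using D assms(3) by auto
      then have "X \<inter> D = {} \<or> \<Union>(A - {X}) \<inter> D = {}"
        using D(1) cl dis unfolding connected_closed by blast
      then show ?thesis
        using \<open>D \<subseteq> X \<union> _\<close> x D(3) by blast
    qed
    then have "connected_component_set S x = X"
      using x A[OF that] that assms(3)
      by (intro connected_component_unique) auto
    then show ?thesis
      using x that assms(3) by (auto simp: components_def)
  qed
  moreover have "C \<in> A" if C: "C \<in> components S" for C
  proof -
    obtain x where "x \<in> C" using in_components_nonempty[OF C] by blast
    moreover obtain X where "X \<in> A" "x \<in> X"
      using assms(3) in_components_subset[OF C] \<open>x \<in> C\<close> by blast
    ultimately show ?thesis
      using components_eq[OF C comp[OF \<open>X \<in> A\<close>]] by auto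
  qed
  ultimately show ?thesis by blast
qed

lemma components_Un_connected:
  fixes X Y :: "'a::topological_space set"
  assumes X: "closed X" "finite (components X)" and Y: "closed Y" "connected Y" "Y \<noteq> {}"
  defines "M \<equiv> {C \<in> components X. C \<inter> Y \<noteq> {}}"
  shows "components (X \<union> Y) = insert (Y \<union> \<Union>M) (components X - M)"
proof (rule components_closed_unique)
  show "finite (insert (Y \<union> \<Union>M) (components X - M))"
    using X by auto
  show "pairwise disjnt (insert (Y \<union> \<Union>M) (components X - M))"
  proof -
    have "disjnt C D" if "C \<in> components X" "D \<in> components X" "C \<noteq> D" for C D
      using components_eq[OF that(1,2)] that(3) by (auto simp: disjnt_def)
    moreover have "disjnt C Y" if "C \<in> components X - M" for C
      using that by (auto simp: M_def disjnt_def)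
    moreover have "M \<subseteq> components X" by (auto simp: M_def)
    ultimately show ?thesis
      unfolding pairwise_insert by (fastforce simp: pairwise_def disjnt_sym disjnt_Un1 disjnt_Un2)
  qed
  show "\<Union>(insert (Y \<union> \<Union>M) (components X - M)) = X \<union> Y"
  proof -
    have "M \<union> (components X - M) = components X"
      by (auto simp: M_def)
    then have "\<Union>M \<union> \<Union>(components X - M) = X"
      by (metis Union_Un_distrib Union_components)
    then show ?thesis by (simp add: Un_assoc Un_commute)
  qed
  have "finite M" using X M_def by auto
  have con: "connected (Y \<union> \<Union>M)"
  proof -
    have "connected (\<Union>(insert Y ((\<lambda>C. C \<union> Y) ` M)))"
      using Y by (intro connected_Union) (auto simp: M_def Int_commute intro!: connected_Un intro: in_components_connected)
    moreover have "\<Union>(insert Y ((\<lambda>C. C \<union> Y) ` M)) = Y \<union> \<Union>M" by auto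
    ultimately show ?thesis by simp
  qed
  have "closed (Y \<union> \<Union>M)"
    using \<open>finite M\<close> Y X unfolding M_def by (auto intro!: closed_Un closed_Union intro: closed_components)
  with con show "closed C \<and> connected C \<and> C \<noteq> {}"
    if "C \<in> insert (Y \<union> \<Union>M) (components X - M)" for C
    using that X(1) Y(3) in_components_connected[of C X] in_components_nonempty[of C X]
      closed_components[of X C] by auto
qed

text \<open>The components that meet \<open>Y\<close> are replaced by a single one. Writing the
  count as a sum avoids subtraction on \<open>nat\<close>; it also covers a \<open>Y\<close> that
  meets nothing and becomes a new component.\<close>

lemma card_components_Un_connected:
  fixes X Y :: "'a::topological_space set"
  assumes X: "closed X" "finite (components X)" and Y: "closed Y" "connected Y" "Y \<noteq> {}"
  shows "finite (components (X \<union> Y))"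
    and "card (components (X \<union> Y)) + card {C \<in> components X. C \<inter> Y \<noteq> {}} = Suc (card (components X))"
proof -
  define M where "M = {C \<in> components X. C \<inter> Y \<noteq> {}}"
  have eq: "components (X \<union> Y) = insert (Y \<union> \<Union>M) (components X - M)"
    unfolding M_def by (rule components_Un_connected[OF assms])
  show "finite (components (X \<union> Y))"
    using X eq by simp
  have "Y \<union> \<Union>M \<notin> components X - M"
    using Y(3) by (auto simp: M_def)
  moreover have "M \<subseteq> components X" by (auto simp: M_def)
  ultimately show "card (components (X \<union> Y)) + card {C \<in> components X. C \<inter> Y \<noteq> {}} = Suc (card (components X))"
    using X(2) card_mono[OF X(2) \<open>M \<subseteq> _\<close>] unfolding eq M_def[symmetric]
    by (simp add: card_Diff_subset finite_subset)
qed

section \<open>Components of the complement after a cross-cut, and the two sides of a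
  segment\<close>

text \<open>\<open>L\<close> and \<open>R\<close> play the role of the two sides of a cross-cut \<open>e - X\<close> of the complement of \<open>X\<close>.\<close>

lemma components_complement_Un_crosscut:
  fixes X e L R :: "'a::real_normed_vector set"
  assumes X: "closed X" "closed e" "connected (e - X)" "x \<in> e - X"
    and L: "connected L" "l \<in> L" "L \<inter> (X \<union> e) = {}" "e - X \<subseteq> closure L"
    and R: "connected R" "r \<in> R" "R \<inter> (X \<union> e) = {}" "e - X \<subseteq> closure R"
    and op: "open (L \<union> R \<union> (e - X))"
  defines "cL \<equiv> connected_component_set (- (X \<union> e)) l"
    and "cR \<equiv> connected_component_set (- (X \<union> e)) r"
    and "U \<equiv> connected_component_set (- X) x"
  shows "components (- (X \<union> e)) = components (- X) - {U} \<union> {cL, cR}"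
    and "cL \<subseteq> U" and "cR \<subseteq> U"
proof -
  have opX: "open (- X)" "open (- (X \<union> e))"
    using X by (auto simp: open_Compl)
  \<comment> \<open>The cut lies in the closure of the side, so side and cut together form a
    connected set off \<open>X\<close>.\<close>
  have side: "connected_component_set (- (X \<union> e)) s \<subseteq> U"
    if S: "connected S" "s \<in> S" "S \<inter> (X \<union> e) = {}" "e - X \<subseteq> closure S" for S s
  proof -
    have "connected (S \<union> (e - X))"
      by (rule connected_intermediate_closure[OF S(1)]) (use S(4) closure_subset in auto)
    then have "S \<union> (e - X) \<subseteq> U"
      unfolding U_def by (rule connected_component_maximal[rotated]) (use X(4) S in auto)
    then have "U = connected_component_set (- X) s"
      unfolding U_def using S(2) connected_component_eq by blast
    then show ?thesis
      by (simp add: connected_component_mono)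
  qed
  show cLU: "cL \<subseteq> U" unfolding cL_def by (rule side[OF L])
  show cRU: "cR \<subseteq> U" unfolding cR_def by (rule side[OF R])
  have cin: "cL \<in> components (- (X \<union> e))" "cR \<in> components (- (X \<union> e))"
    using L R by (auto simp: cL_def cR_def components_def)
  have Uin: "U \<in> components (- X)"
    using X(4) by (auto simp: U_def components_def)
  have eU: "e - X \<subseteq> U"
    unfolding U_def by (rule connected_component_maximal) (use X in auto)
  have LcL: "L \<subseteq> cL" "R \<subseteq> cR"
    unfolding cL_def cR_def by (rule connected_component_maximal; use L R in auto)+
  \<comment> \<open>Here openness of the tube is decisive. A third component \<open>W\<close> would
    be disjoint from the tube; the tube and all components other than \<open>W\<close> form an open
    \<open>V\<close> that misses \<open>W\<close>, and \<open>W\<close> and \<open>V\<close> would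
    disconnect \<open>U\<close>.\<close>
  have meets: "W = cL \<or> W = cR" if W: "W \<in> components (- (X \<union> e))" "W \<inter> U \<noteq> {}" for W
  proof (rule ccontr)
    assume *: "\<not> (W = cL \<or> W = cR)"
    then have disj: "W \<inter> L = {}" "W \<inter> R = {}"
      using components_eq[OF W(1) cin(1)] components_eq[OF W(1) cin(2)] LcL by blast+
    have Wsub: "W \<subseteq> - (X \<union> e)" using in_components_subset[OF W(1)] .
    define V where "V = (L \<union> R \<union> (e - X)) \<union> (\<Union>(components (- (X \<union> e)) - {W}))"
    have "open V"
      unfolding V_def by (rule open_Un[OF op]) (use opX open_components in blast)
    have "open W" using W opX open_components by blast
    have WV: "W \<inter> V = {}"
      using disj Wsub components_eq[OF W(1)] by (auto simp: V_def)
    have "- (X \<union> e) \<subseteq> W \<union> V"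
    proof
      fix z assume "z \<in> - (X \<union> e)"
      then obtain C where "C \<in> components (- (X \<union> e))" "z \<in> C"
        by (metis UnionE Union_components)
      then show "z \<in> W \<union> V" by (auto simp: V_def)
    qed
    then have "- X \<subseteq> W \<union> V"
      by (auto simp: V_def)
    moreover have "U \<subseteq> - X" using Uin in_components_subset by blast
    moreover have "x \<in> V" "x \<in> U" using X(4) eU by (auto simp: V_def)
    moreover have "connected U" using Uin in_components_connected by blast
    ultimately show False
      using connectedD[of U W V] W(2) WV \<open>open W\<close> \<open>open V\<close> by blast
  qed
  show "components (- (X \<union> e)) = components (- X) - {U} \<union> {cL, cR}"
  proof (intro equalityI subsetI)
    fix W assume W: "W \<in> components (- (X \<union> e))"
    show "W \<in> components (- X) - {U} \<union> {cL, cR}"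
    proof (cases "W \<inter> U = {}")
      case True
      obtain w where w: "w \<in> W" using in_components_nonempty[OF W] by blast
      then have wX: "w \<in> - X" using in_components_subset[OF W] by blast
      define V where "V = connected_component_set (- X) w"
      have V: "V \<in> components (- X)" "w \<in> V" using wX by (auto simp: V_def components_def)
      have "V \<noteq> U" using V w True by auto
      then have "V \<inter> U = {}" using components_eq[OF V(1) Uin] by blast
      then have "V \<subseteq> - (X \<union> e)" using in_components_subset[OF V(1)] eU by blast
      then have "V \<subseteq> W"
        using components_maximal[OF W, of V] V w in_components_connected by blast
      moreover have "W \<subseteq> V"
        using components_maximal[OF V(1), of W] W V w in_components_connected in_components_subset[OF W] by blast
      ultimately show ?thesis using V \<open>V \<noteq> U\<close> by auto
    qed (use meets W in blast)
  next
    fix V assume "V \<in> components (- X) - {U} \<union> {cL, cR}"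
    then consider "V \<in> components (- X)" "V \<noteq> U" | "V \<in> {cL, cR}" by blast
    then show "V \<in> components (- (X \<union> e))"
    proof cases
      case 1
      have "V \<inter> U = {}" using components_eq[OF 1(1) Uin] 1 by blast
      then have "V \<subseteq> - (X \<union> e)" using in_components_subset[OF 1(1)] eU by blast
      then show ?thesis
        using 1 in_components_maximal[of V "-X"] in_components_maximal[of V "- (X \<union> e)"] by auto
    qed (use cin in auto)
  qed
qed

text \<open>One component of \<open>- X\<close> gives way to those of \<open>l\<close> and of
  \<open>r\<close>, which coincide or are disjoint, so the count depends only on whether the two
  sides remain joined.\<close>

lemma card_components_complement_Un_crosscut:
  fixes X e L R :: "'a::real_normed_vector set"
  assumes X: "closed X" "closed e" "connected (e - X)" "e - X \<noteq> {}" "finite (components (- X))"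
    and L: "connected L" "l \<in> L" "L \<inter> (X \<union> e) = {}" "e - X \<subseteq> closure L"
    and R: "connected R" "r \<in> R" "R \<inter> (X \<union> e) = {}" "e - X \<subseteq> closure R"
    and op: "open (L \<union> R \<union> (e - X))"
  shows "finite (components (- (X \<union> e)))"
    and "card (components (- (X \<union> e))) =
      card (components (- X)) + (if connected_component (- (X \<union> e)) l r then 0 else 1)"
proof -
  obtain x where x: "x \<in> e - X" using X by blast
  define cL where "cL = connected_component_set (- (X \<union> e)) l"
  define cR where "cR = connected_component_set (- (X \<union> e)) r"
  define U where "U = connected_component_set (- X) x"
  note split = components_complement_Un_crosscut[OF X(1-3) x L R op, folded cL_def cR_def U_def]
  have Uin: "U \<in> components (- X)"
    using x by (auto simp: U_def components_def)
  have "l \<in> cL" "r \<in> cR"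
    using L R by (auto simp: cL_def cR_def)
  then have ne: "cL \<noteq> {}" "cR \<noteq> {}" by auto
  have new: "cL \<notin> components (- X) - {U}" "cR \<notin> components (- X) - {U}"
    using split(2,3) ne components_eq[OF _ Uin] by blast+
  have same: "cL = cR \<longleftrightarrow> connected_component (- (X \<union> e)) l r"
    using L R unfolding cL_def cR_def by (subst connected_component_eq_eq) blast
  show "finite (components (- (X \<union> e)))"
    using split(1) X(5) by simp
  have pos: "card (components (- X)) > 0" using X(5) Uin card_gt_0_iff by blast
  have "card (components (- X) - {U}) = card (components (- X)) - 1"
    using Uin by simp
  then show "card (components (- (X \<union> e))) =
      card (components (- X)) + (if connected_component (- (X \<union> e)) l r then 0 else 1)"
    using new X(5) pos unfolding split(1) same[symmetric]
    by (simp add: Un_insert_right card_insert_if)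
qed

lemma open_segment_eq_closed_segment_diff: "closed_segment a b - X = open_segment a b"
  if "a \<in> X" "b \<in> X" "open_segment a b \<inter> X = {}"
  using that by (auto simp: open_segment_def)

text \<open>The sides are the two halves of a tube around the segment whose width at a point is governed
  by the distance of that point to \<open>X\<close>.\<close>

lemma segment_sides:
  fixes a b :: "real^2"
  assumes X: "closed X" "a \<in> X" "a \<noteq> b" "open_segment a b \<inter> X = {}"
  obtains L R l r where
    "connected L" "l \<in> L" "L \<inter> (X \<union> closed_segment a b) = {}" "open_segment a b \<subseteq> closure L"
    "connected R" "r \<in> R" "R \<inter> (X \<union> closed_segment a b) = {}" "open_segment a b \<subseteq> closure R"
    "open (L \<union> R \<union> open_segment a b)"
proof -
  define d where "d = b - a"
  \<comment> \<open>\<open>n\<close> is \<open>d\<close> turned by a right angle and has the same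
    length. Thus \<open>p\<close> is a linear coordinate system with its first axis along the
    segment, and \<open>\<tau>\<close>, \<open>\<sigma>\<close> are the coordinates of a point in
    it.\<close>
  define n :: "real^2" where "n = vector [- (d$2), d$1]"
  define p where "p t s = a + t *\<^sub>R d + s *\<^sub>R n" for t s
  define \<tau> where "\<tau> z = ((z - a) \<bullet> d) / (d \<bullet> d)" for z
  define \<sigma> where "\<sigma> z = ((z - a) \<bullet> n) / (d \<bullet> d)" for z
  \<comment> \<open>Dividing by \<open>norm n\<close> makes \<open>\<bar>s\<bar> < f t\<close> say
    that \<open>p t s\<close> is closer to \<open>p t 0\<close> than \<open>X\<close> is, which
    keeps \<open>p t s\<close> off \<open>X\<close>.\<close>
  define f where "f t = infdist (p t 0) X / norm n" for t
  have "d \<noteq> 0" using X by (simp add: d_def)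
  then have dd: "d \<bullet> d \<noteq> 0" by simp
  have nn: "n \<bullet> n = d \<bullet> d" "d \<bullet> n = 0" "n \<bullet> d = 0"
    by (auto simp: n_def inner_vec_def sum_2)
  have "n \<noteq> 0" using nn(1) dd by auto
  have \<tau>p: "\<tau> (p t s) = t" and \<sigma>p: "\<sigma> (p t s) = s" for t s
    using dd nn by (auto simp: \<tau>_def \<sigma>_def p_def algebra_simps)
  have p\<tau>\<sigma>: "p (\<tau> z) (\<sigma> z) = z" for z
  proof -
    have nz: "d$1 * d$1 + d$2 * d$2 \<noteq> 0" using dd by (simp add: inner_vec_def sum_2)
    show ?thesis
      using nz by (auto simp: vec_eq_iff forall_2 p_def \<tau>_def \<sigma>_def n_def inner_vec_def sum_2
          divide_simps) (simp_all add: algebra_simps)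
  qed
  have seg: "open_segment a b = {p t 0 |t. 0 < t \<and> t < 1}"
    using X(3) by (auto simp: in_segment p_def d_def algebra_simps)
  have cseg: "closed_segment a b = {p t 0 |t. 0 \<le> t \<and> t \<le> 1}"
    by (auto simp: in_segment p_def d_def algebra_simps)
  have cont_p: "continuous_on A (\<lambda>x. p (g x) (h x))" if "continuous_on A g" "continuous_on A h"
    for g h and A :: "'z::topological_space set"
    unfolding p_def by (intro continuous_intros that)
  have cont_f: "continuous_on A (\<lambda>x. f (g x))" if "continuous_on A g"
    for g and A :: "'z::topological_space set"
    unfolding f_def divide_inverse by (intro continuous_intros cont_p that)
  have f_pos: "f t > 0" if "0 < t" "t < 1" for t
  proof -
    have "p t 0 \<notin> X" using X(4) seg that by auto
    \<comment> \<open>The point \<open>a\<close> witnesses that \<open>X\<close> is non-empty;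
      \<open>infdist\<close> to the empty set is \<open>0\<close> by convention.\<close>
    then have "infdist (p t 0) X > 0"
      using X infdist_pos_not_in_closed[of X "p t 0"] by auto
    then show ?thesis using \<open>n \<noteq> 0\<close> by (simp add: f_def)
  qed
  define D where "D = {0<..<1::real} \<times> {0<..<1::real}"
  \<comment> \<open>The values \<open>1\<close> and \<open>-1\<close> of \<open>c\<close> give the
    two half-tubes. The parameter \<open>u\<close> is the height as a fraction of
    \<open>f t\<close>, so each half is a continuous image of an open square and therefore
    connected.\<close>
  define S where "S c = (\<lambda>(t,u). p t (c * u * f t)) ` D" for c
  have contS: "continuous_on A (\<lambda>(t,u). p t (c * u * f t))" for c and A :: "(real \<times> real) set"
    unfolding case_prod_unfold by (intro cont_p cont_f continuous_intros)
  have conS: "connected (S c)" for c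
    unfolding S_def D_def by (intro connected_continuous_image contS convex_connected convex_Times) auto
  have inS: "p (1/2) (c * (1/2) * f (1/2)) \<in> S c" for c
    unfolding S_def D_def by (rule image_eqI[of _ _ "(1/2, 1/2)"]) auto
  have outS: "S c \<inter> (X \<union> closed_segment a b) = {}" if "\<bar>c\<bar> = 1" for c
  proof -
    have "p t (c * u * f t) \<notin> X \<and> p t (c * u * f t) \<notin> closed_segment a b"
      if tu: "0 < t" "t < 1" "0 < u" "u < 1" for t u
    proof
      have "dist (p t 0) (p t (c * u * f t)) = u * f t * norm n"
        using \<open>\<bar>c\<bar> = 1\<close> tu f_pos[of t] by (simp add: p_def dist_norm abs_mult)
      also have "\<dots> < f t * norm n"
        using tu f_pos[of t] \<open>n \<noteq> 0\<close> by simp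
      also have "\<dots> = infdist (p t 0) X"
        using \<open>n \<noteq> 0\<close> by (simp add: f_def)
      finally show "p t (c * u * f t) \<notin> X"
        using infdist_le[of "p t (c * u * f t)" X "p t 0"] by auto
      have "c * u * f t \<noteq> 0" using tu f_pos[of t] that \<open>\<bar>c\<bar> = 1\<close> by auto
      then show "p t (c * u * f t) \<notin> closed_segment a b"
        unfolding cseg using \<sigma>p[of t "c * u * f t"] \<sigma>p[of _ 0] by auto
    qed
    then show ?thesis by (auto simp: S_def D_def)
  qed
  have closS: "open_segment a b \<subseteq> closure (S c)" for c
  proof
    fix y assume "y \<in> open_segment a b"
    then obtain t where t: "0 < t" "t < 1" "y = p t 0" using seg by auto
    have "(\<lambda>(t,u). p t (c * u * f t)) ` closure D \<subseteq> closure (S c)"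
      by (rule image_closure_subset[OF contS]) (simp_all add: S_def closure_subset)
    moreover have "(t, 0) \<in> closure D"
      using t by (simp add: D_def closure_Times)
    ultimately show "y \<in> closure (S c)"
      using t by force
  qed
  \<comment> \<open>In the coordinates \<open>\<tau>\<close> and \<open>\<sigma>\<close> the tube is
    cut out by strict inequalities between continuous functions, which makes it open.\<close>
  have "S 1 \<union> S (-1) \<union> open_segment a b = {z. 0 < \<tau> z \<and> \<tau> z < 1 \<and> \<bar>\<sigma> z\<bar> < f (\<tau> z)}" (is "?N = ?M")
  proof (intro equalityI subsetI)
    fix z assume "z \<in> ?N"
    then show "z \<in> ?M"
      by (auto simp: S_def D_def seg \<tau>p \<sigma>p abs_mult abs_of_pos f_pos)
  next
    fix z assume z: "z \<in> ?M"
    then have fp: "f (\<tau> z) > 0" using f_pos by auto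
    have zp: "z = p (\<tau> z) (sgn (\<sigma> z) * (\<bar>\<sigma> z\<bar> / f (\<tau> z)) * f (\<tau> z))"
      using fp p\<tau>\<sigma>[of z] by (simp add: sgn_mult_abs)
    show "z \<in> ?N"
    proof (cases "\<sigma> z = 0")
      case True
      then show ?thesis using z p\<tau>\<sigma>[of z] unfolding seg by (intro UnI2) (auto intro!: exI[of _ "\<tau> z"])
    next
      case False
      then have "z \<in> S (sgn (\<sigma> z))"
        unfolding S_def D_def using z fp
        by (intro image_eqI[of _ _ "(\<tau> z, \<bar>\<sigma> z\<bar> / f (\<tau> z))"]) (use zp in auto)
      then show ?thesis using False by (auto simp: sgn_if split: if_splits)
    qed
  qed
  moreover have "open ?M"
  proof -
    have ct: "continuous_on UNIV \<tau>" "continuous_on UNIV \<sigma>"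
      unfolding \<tau>_def \<sigma>_def divide_inverse by (intro continuous_intros)+
    show ?thesis
      by (intro open_Collect_conj open_Collect_less continuous_intros cont_f ct)
  qed
  ultimately have "open ?N" by simp
  then show thesis
    by (intro that[of "S 1" _ "S (-1)"]) (use conS inS outS closS in auto)
qed

section \<open>Janiszewski's theorem and its dual, carried from the complex plane to
  \<open>real^2\<close>\<close>

lemma homeomorphism_complex_vec2:
  "homeomorphism UNIV UNIV (\<lambda>x::real^2. Complex (x$1) (x$2)) (\<lambda>z. vector [Re z, Im z])"
proof -
  have "continuous_on UNIV (\<lambda>z. vector [Re z, Im z] :: real^2)"
  proof -
    have eq: "(vector [Re z, Im z] :: real^2) = Re z *\<^sub>R vector [1,0] + Im z *\<^sub>R vector [0,1]" for z
      by (auto simp: vec_eq_iff forall_2)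
    show ?thesis unfolding eq by (intro continuous_intros)
  qed
  moreover have "continuous_on UNIV (\<lambda>x::real^2. Complex (x$1) (x$2))"
    unfolding Complex_eq by (intro continuous_intros)
  ultimately show ?thesis
    by (intro homeomorphismI) (auto simp: vec_eq_iff forall_2)
qed

lemma homeomorphism_UNIV_Compl_image:
  assumes "homeomorphism UNIV UNIV f g"
  shows "- (f ` S) = f ` (- S)"
  using assms by (metis bij_image_Compl_eq bij_betw_def homeomorphism_def inj_on_def UNIV_I)

lemma Janiszewski_vec2:
  fixes a b :: "real^2"
  assumes "compact S" "closed T" "connected (S \<inter> T)"
    and "connected_component (- S) a b" "connected_component (- T) a b"
  shows "connected_component (- (S \<union> T)) a b"
proof -
  obtain f :: "real^2 \<Rightarrow> complex" and g where hom: "homeomorphism UNIV UNIV f g"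
    using homeomorphism_complex_vec2 by blast
  have cont: "continuous_on A f" "continuous_on B g" for A B
    using hom by (auto simp: homeomorphism_def intro: continuous_on_subset)
  have gf: "g (f x) = x" for x using hom by (auto simp: homeomorphism_def)
  have inj: "inj f" using gf by (metis injI)
  have im: "connected_component (f ` A) (f x) (f y)" if "connected_component A x y" for A x y
    using that cont unfolding connected_component_def
    by (metis connected_continuous_image image_eqI image_mono)
  have "connected_component (- (f ` S \<union> f ` T)) (f a) (f b)"
  proof (rule Janiszewski)
    show "compact (f ` S)" using assms cont compact_continuous_image by blast
    show "closed (f ` T)"
    proof -
      have "f ` T = g -` T"
        using hom by (auto simp: homeomorphism_def image_iff) metis
      then show ?thesis using closed_vimage[OF assms(2) cont(2)] by simp
    qed
    show "connected (f ` S \<inter> f ` T)"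
      using assms(3) cont inj by (metis connected_continuous_image image_Int)
    show "connected_component (- f ` S) (f a) (f b)" "connected_component (- f ` T) (f a) (f b)"
      using assms im homeomorphism_UNIV_Compl_image[OF hom] by metis+
  qed
  then obtain C where C: "connected C" "C \<subseteq> - (f ` (S \<union> T))" "f a \<in> C" "f b \<in> C"
    unfolding connected_component_def image_Un by blast
  have "connected (g ` C)" using C cont connected_continuous_image by blast
  moreover have "g ` C \<subseteq> - (S \<union> T)"
    using C(2) hom by (auto simp: homeomorphism_def) (metis UnCI image_eqI subsetD ComplD)+
  moreover have "a \<in> g ` C" "b \<in> g ` C" using C gf by (metis image_eqI)+
  ultimately show ?thesis unfolding connected_component_def by blast
qed

lemma Janiszewski_dual_vec2:
  fixes S :: "(real^2) set"
  assumes "compact S" "compact T" "connected S" "connected T" "connected (- (S \<union> T))"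
  shows "connected (S \<inter> T)"
proof -
  obtain f :: "real^2 \<Rightarrow> complex" and g where hom: "homeomorphism UNIV UNIV f g"
    using homeomorphism_complex_vec2 by blast
  have cont: "continuous_on A f" "continuous_on B g" for A B
    using hom by (auto simp: homeomorphism_def intro: continuous_on_subset)
  have gf: "g (f x) = x" for x using hom by (auto simp: homeomorphism_def)
  have inj: "inj f" using gf by (metis injI)
  have "connected (f ` S \<inter> f ` T)"
  proof (rule Janiszewski_dual)
    show "connected (- (f ` S \<union> f ` T))"
      using assms(5) cont homeomorphism_UNIV_Compl_image[OF hom]
      by (metis connected_continuous_image image_Un)
  qed (use assms cont compact_continuous_image connected_continuous_image in blast)+
  then have "connected (g ` f ` (S \<inter> T))"
    using inj cont by (metis connected_continuous_image image_Int)
  then show ?thesis by (simp add: image_image gf)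
qed

section \<open>When a segment separates its two sides\<close>

text \<open>If the ends lie in different components, \<open>X\<close> splits into closed sets
  \<open>A\<close> and \<open>B\<close>, and \<open>A\<close>, the segment and \<open>B\<close> form
  a chain in which successive intersections are single points; two applications of Janiszewski's
  theorem show that nothing gets separated. If the ends are joined in \<open>X\<close>, an arc and
  the segment form a closed curve that meets itself in the disconnected set \<open>{a, b}\<close>,
  and the dual theorem forces its complement to be disconnected.\<close>

lemma crosscut_sides_connected_iff:
  fixes X :: "(real^2) set"
  assumes X: "compact X" "locally path_connected X" "finite (components X)"
    and ab: "a \<in> X" "b \<in> X" "a \<noteq> b" "open_segment a b \<inter> X = {}"
    and L: "connected L" "l \<in> L" "L \<inter> (X \<union> closed_segment a b) = {}" "open_segment a b \<subseteq> closure L"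
    and R: "connected R" "r \<in> R" "R \<inter> (X \<union> closed_segment a b) = {}" "open_segment a b \<subseteq> closure R"
    and op: "open (L \<union> R \<union> open_segment a b)"
  shows "connected_component (- (X \<union> closed_segment a b)) l r \<longleftrightarrow> \<not> connected_component X a b"
proof
  assume nc: "\<not> connected_component X a b"
  define A where "A = connected_component_set X a"
  define B where "B = \<Union>(components X - {A})"
  have Ain: "A \<in> components X" using ab by (auto simp: A_def components_def)
  have clX: "closed X" using X compact_imp_closed by blast
  have AB: "X = A \<union> B"
  proof -
    have "insert A (components X - {A}) = components X" using Ain by auto
    then have "A \<union> B = \<Union>(components X)" unfolding B_def by (metis Union_insert)
    then show ?thesis by simp
  qed
  have disj: "A \<inter> B = {}" using components_eq[OF Ain] by (auto simp: B_def)
  have "closed A" using clX closed_components Ain by blast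
  then have "compact A" using X(1) AB by (metis Un_upper1 closed_Int_compact inf.absorb1)
  have "closed B" unfolding B_def using X(3) clX closed_components by blast
  have aA: "a \<in> A" "b \<notin> A" using ab nc by (auto simp: A_def)
  then have bB: "b \<in> B" "a \<notin> B" using ab AB disj by auto
  have ce: "closed_segment a b = insert a (insert b (open_segment a b))"
    by (auto simp: open_segment_def)
  have Ae: "A \<inter> closed_segment a b = {a}" and Be: "B \<inter> closed_segment a b = {b}"
    unfolding ce using aA bB ab(4) AB by auto
  \<comment> \<open>Both sides have the open segment in their closure and \<open>X\<close> misses
    it, so they are joined across it.\<close>
  have tube: "connected_component (- X) l r"
  proof -
    have "connected (L \<union> open_segment a b)" "connected (R \<union> open_segment a b)"
      by (rule connected_intermediate_closure[OF L(1)], use L(4) closure_subset in auto)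
         (rule connected_intermediate_closure[OF R(1)], use R(4) closure_subset in auto)
    then have "connected ((L \<union> open_segment a b) \<union> (R \<union> open_segment a b))"
      by (rule connected_Un) (use ab(3) in \<open>auto simp: Int_Un_distrib Int_Un_distrib2\<close>)
    then show ?thesis
      unfolding connected_component_def using L(2,3) R(2,3) ab(4)
      by (intro exI[of _ "(L \<union> open_segment a b) \<union> (R \<union> open_segment a b)"]) auto
  qed
  then have lrA: "connected_component (- A) l r" and lrB: "connected_component (- B) l r"
    using AB by (auto elim!: connected_component_of_subset)
  have "connected (- closed_segment a b)"
    by (rule connected_complement_bounded_convex) (auto simp: bounded_closed_segment)
  then have lre: "connected_component (- closed_segment a b) l r"
    using L R unfolding connected_component_def by (intro exI[of _ "- closed_segment a b"]) auto
  have "connected_component (- (A \<union> closed_segment a b)) l r"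
    using \<open>compact A\<close> Ae lrA lre by (intro Janiszewski_vec2) auto
  then have "connected_component (- ((A \<union> closed_segment a b) \<union> B)) l r"
  proof (rule Janiszewski_vec2[rotated 3])
    have "(A \<union> closed_segment a b) \<inter> B = {b}" using Be disj by auto
    then show "connected ((A \<union> closed_segment a b) \<inter> B)" by simp
  qed (use \<open>compact A\<close> \<open>closed B\<close> lrB in \<open>auto intro: compact_Un\<close>)
  then show "connected_component (- (X \<union> closed_segment a b)) l r"
    using AB by (simp add: Un_ac)
next
  assume lr: "connected_component (- (X \<union> closed_segment a b)) l r"
  show "\<not> connected_component X a b"
  proof
    assume "connected_component X a b"
    \<comment> \<open>Local path connectedness is what turns a connection inside \<open>X\<close>
      into a path, and then into an arc.\<close>
    then have "path_component X a b"
      using X(2) path_component_eq_connected_component by metis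
    then obtain g0 where "path g0" "path_image g0 \<subseteq> X" "pathstart g0 = a" "pathfinish g0 = b"
      unfolding path_component_def by blast
    then obtain g where g: "arc g" "path_image g \<subseteq> X" "pathstart g = a" "pathfinish g = b"
      using path_contains_arc[of g0 a b] ab(3) by (metis order_trans)
    define G where "G = path_image g"
    have abG: "a \<in> G" "b \<in> G" using g by (auto simp: G_def)
    have G: "compact G" "connected G" "G \<subseteq> X"
      using g by (auto simp: G_def compact_arc_image connected_arc_image)
    have eG: "closed_segment a b - G = open_segment a b"
      using open_segment_eq_closed_segment_diff[OF abG] ab(4) G(3) by blast
    \<comment> \<open>An arc does not separate the plane, so the cross-cut count with
      \<open>G\<close> in place of \<open>X\<close> starts from one component; joined sides would
      leave the complement of the closed curve connected.\<close>
    have "connected (- G)"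
      unfolding G_def using g by (intro connected_arc_complement) auto
    moreover have "- G \<noteq> {}" using L(2,3) G(3) by auto
    ultimately have cG: "components (- G) = {- G}" by (simp add: components_eq_sing_iff)
    have "connected_component (- (G \<union> closed_segment a b)) l r"
      using lr by (rule connected_component_of_subset) (use G(3) in auto)
    moreover have "card (components (- (G \<union> closed_segment a b))) =
        card (components (- G)) + (if connected_component (- (G \<union> closed_segment a b)) l r then 0 else 1)"
    proof (rule card_components_complement_Un_crosscut(2), unfold eG)
      show "L \<inter> (G \<union> closed_segment a b) = {}" "R \<inter> (G \<union> closed_segment a b) = {}"
        using L(3) R(3) G(3) by auto
    qed (use L R op ab(3) cG compact_imp_closed[OF G(1)] convex_connected[OF convex_open_segment] in auto)
    ultimately have "card (components (- (G \<union> closed_segment a b))) = 1"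
      using cG by simp
    then have "connected (- (G \<union> closed_segment a b))"
      using components_eq_sing_exists card_1_singletonE by metis
    then have "connected (G \<inter> closed_segment a b)"
      using G by (intro Janiszewski_dual_vec2) auto
    moreover have "G \<inter> closed_segment a b = {a, b}"
      using eG abG by (auto simp: open_segment_def)
    ultimately show False
      using ab(3) connected_finite_iff_sing[of "{a,b}"] by auto
  qed
qed

section \<open>Attaching a point, an edge or a convex body\<close>

text \<open>In dimension at least two a connected open set stays connected when a point is deleted,
  so the component of the complement around \<open>v\<close> merely loses \<open>v\<close>.\<close>

lemma components_Un_point:
  fixes X :: "'a::euclidean_space set"
  assumes dim: "2 \<le> DIM('a)" and X: "closed X" "v \<notin> X" "finite (components X)" "finite (components (- X))"
  shows "finite (components (X \<union> {v}))" "card (components (X \<union> {v})) = Suc (card (components X))"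
    and "finite (components (- (X \<union> {v})))"
    and "card (components (- (X \<union> {v}))) = card (components (- X))"
proof -
  have M: "{C \<in> components X. C \<inter> {v} \<noteq> {}} = {}"
    using X(2) in_components_subset by fastforce
  show "finite (components (X \<union> {v}))" "card (components (X \<union> {v})) = Suc (card (components X))"
    using card_components_Un_connected[of X "{v}", unfolded M] X by simp_all
  define U where "U = connected_component_set (- X) v"
  have U: "U \<in> components (- X)" "v \<in> U"
    using X(2) by (auto simp: U_def components_def)
  have op: "open C" if "C \<in> components (- X)" for C
    using that X(1) open_components by blast
  have "connected (U - {v})"
    using connected_open_delete[OF op[OF U(1)]] in_components_connected[OF U(1)] dim by blast
  have Une: "U - {v} \<noteq> {}"
    using op[OF U(1)] U(2) not_open_singleton[of v] by (metis Diff_eq_empty_iff subset_singletonD empty_iff)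
  have dis: "C \<inter> U = {}" if "C \<in> components (- X)" "C \<noteq> U" for C
    using components_eq[OF that(1) U(1)] that(2) by blast
  have eq: "components (- (X \<union> {v})) = insert (U - {v}) (components (- X) - {U})"
  proof (rule components_open_unique)
    show "pairwise disjnt (insert (U - {v}) (components (- X) - {U}))"
      using pairwise_disjoint_components[of "- X"] dis
      unfolding pairwise_insert by (fastforce simp: pairwise_def disjnt_def)
    have "insert U (components (- X) - {U}) = components (- X)" using U(1) by auto
    then have "U \<union> \<Union>(components (- X) - {U}) = - X"
      by (metis Union_insert Union_components)
    moreover have "v \<notin> \<Union>(components (- X) - {U})"
      using dis U(2) by blast
    ultimately show "\<Union>(insert (U - {v}) (components (- X) - {U})) = - (X \<union> {v})"
      by auto
    show "open C \<and> connected C \<and> C \<noteq> {}" if "C \<in> insert (U - {v}) (components (- X) - {U})" for C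
      using that op[of C] op[OF U(1)] in_components_connected[of C] in_components_nonempty[of C]
        \<open>connected (U - {v})\<close> Une by auto
  qed
  then show "finite (components (- (X \<union> {v})))" using X by simp
  have "U - {v} \<notin> components (- X) - {U}"
    using dis[of "U - {v}"] Une by auto
  then show "card (components (- (X \<union> {v}))) = card (components (- X))"
    using X(4) card_Suc_Diff1[OF X(4) U(1)] unfolding eq by simp
qed

text \<open>Only the difference of the two counts changes uniformly. Whether \<open>X\<close>
  already joins \<open>a\<close> to \<open>b\<close> decides which count changes, and by
  \<open>crosscut_sides_connected_iff\<close> this one condition governs both.\<close>

lemma components_Un_segment:
  fixes X :: "(real^2) set"
  assumes X: "compact X" "locally path_connected X" "finite (components X)" "finite (components (- X))"
    and ab: "a \<noteq> b" "closed_segment a b \<inter> X = {a, b}"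
  shows "finite (components (X \<union> closed_segment a b))"
    and "finite (components (- (X \<union> closed_segment a b)))"
    and "int (card (components (X \<union> closed_segment a b))) - int (card (components (- (X \<union> closed_segment a b))))
       = int (card (components X)) - int (card (components (- X))) - 1"
proof -
  let ?e = "closed_segment a b"
  have clX: "closed X" using X compact_imp_closed by blast
  have abX: "a \<in> X" "b \<in> X" "open_segment a b \<inter> X = {}"
    using ab(2) by (auto simp: open_segment_def)
  have eX: "?e - X = open_segment a b"
    by (rule open_segment_eq_closed_segment_diff[OF abX])
  obtain L R l r where LR:
    "connected L" "l \<in> L" "L \<inter> (X \<union> ?e) = {}" "open_segment a b \<subseteq> closure L"
    "connected R" "r \<in> R" "R \<inter> (X \<union> ?e) = {}" "open_segment a b \<subseteq> closure R"
    "open (L \<union> R \<union> open_segment a b)"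
    using segment_sides[OF clX abX(1) ab(1) abX(3)] by metis
  have conn: "connected_component (- (X \<union> ?e)) l r \<longleftrightarrow> \<not> connected_component X a b"
    by (rule crosscut_sides_connected_iff[OF X(1-3) abX(1,2) ab(1) abX(3) LR])
  have compl: "finite (components (- (X \<union> ?e)))"
    "card (components (- (X \<union> ?e))) =
      card (components (- X)) + (if connected_component (- (X \<union> ?e)) l r then 0 else 1)"
    using card_components_complement_Un_crosscut[of X ?e L l R r] clX eX X(4) LR ab(1)
      convex_connected[OF convex_open_segment[of a b]] by simp_all
  show "finite (components (- (X \<union> ?e)))" by (rule compl)
  have un: "finite (components (X \<union> ?e))"
    "card (components (X \<union> ?e)) + card {C \<in> components X. C \<inter> ?e \<noteq> {}} = Suc (card (components X))"
    using card_components_Un_connected[of X ?e] clX X(3) by auto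
  show "finite (components (X \<union> ?e))" by (rule un)
  have M: "{C \<in> components X. C \<inter> ?e \<noteq> {}} = {connected_component_set X a, connected_component_set X b}"
  proof (intro equalityI subsetI)
    fix C assume C: "C \<in> {C \<in> components X. C \<inter> ?e \<noteq> {}}"
    then obtain z where "z \<in> C" "z \<in> ?e \<inter> X"
      using in_components_subset[of C X] by auto
    then have "a \<in> C \<or> b \<in> C"
      unfolding ab(2) by auto
    then show "C \<in> {connected_component_set X a, connected_component_set X b}"
      using C by (metis (no_types, lifting) components_iff connected_component_eq insertCI mem_Collect_eq)
  next
    fix C assume "C \<in> {connected_component_set X a, connected_component_set X b}"
    then show "C \<in> {C \<in> components X. C \<inter> ?e \<noteq> {}}"
      using abX by (auto simp: components_def intro: connected_component_refl)
  qed
  have same: "connected_component_set X a = connected_component_set X b \<longleftrightarrow> connected_component X a b"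
    using abX by (subst connected_component_eq_eq) blast
  have "card {C \<in> components X. C \<inter> ?e \<noteq> {}} = (if connected_component X a b then 1 else 2)"
    unfolding M same[symmetric] by (auto simp: card_insert_if)
  then show "int (card (components (X \<union> ?e))) - int (card (components (- (X \<union> ?e))))
       = int (card (components X)) - int (card (components (- X))) - 1"
    using un(2) compl(2) conn by (auto split: if_splits)
qed

text \<open>The frontier of \<open>S\<close> is connected in dimension at least two, so
  \<open>S\<close> touches exactly one component of \<open>X\<close>. The interior of
  \<open>S\<close> is itself a component of \<open>- X\<close>, and it is the only one lost.\<close>

lemma components_Un_convex_body:
  fixes X S :: "'a::euclidean_space set"
  assumes dim: "2 \<le> DIM('a)"
    and X: "closed X" "finite (components X)" "finite (components (- X))"
    and S: "compact S" "convex S" "interior S \<noteq> {}" "S \<inter> X = frontier S"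
  shows "finite (components (X \<union> S))" "card (components (X \<union> S)) = card (components X)"
    and "finite (components (- (X \<union> S)))"
    and "Suc (card (components (- (X \<union> S)))) = card (components (- X))"
proof -
  have "affine hull S = UNIV" using S(3) affine_hull_nonempty_interior by blast
  then have rf: "rel_frontier S = frontier S" and ad: "aff_dim S = DIM('a)"
    by (auto simp: rel_frontier_frontier aff_dim_eq_full)
  have con: "connected (frontier S)"
    using connected_sphere_gen[of S] S ad dim compact_imp_bounded unfolding rf by fastforce
  have ne: "frontier S \<noteq> {}"
    using S compact_imp_bounded[OF S(1)] not_bounded_UNIV frontier_eq_empty[of S] interior_empty by metis
  then obtain x where x: "x \<in> frontier S" by blast
  have clS: "closed S" using S(1) compact_imp_closed by blast
  have fX: "frontier S \<subseteq> X" using S(4) by blast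
  have M: "{C \<in> components X. C \<inter> S \<noteq> {}} = {connected_component_set X x}"
  proof (intro equalityI subsetI)
    fix C assume C: "C \<in> {C \<in> components X. C \<inter> S \<noteq> {}}"
    then have "C \<inter> frontier S \<noteq> {}" using S(4) in_components_subset[of C X] by blast
    then have "frontier S \<subseteq> C" using C components_maximal[of C X "frontier S"] con fX by blast
    then show "C \<in> {connected_component_set X x}"
      using C x by (metis (no_types, lifting) components_iff connected_component_eq insertCI mem_Collect_eq subsetD)
  next
    fix C assume "C \<in> {connected_component_set X x}"
    then show "C \<in> {C \<in> components X. C \<inter> S \<noteq> {}}"
      using x fX S(4) by (auto simp: components_def intro: connected_component_refl)
  qed
  show "finite (components (X \<union> S))" "card (components (X \<union> S)) = card (components X)"
    using card_components_Un_connected[of X S] X S clS M convex_connected[OF S(2)] interior_subset by auto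
  have op: "open (- (X \<union> S))" using X clS by (intro open_Compl closed_Un)
  have eq: "components (- X) = insert (interior S) (components (- (X \<union> S)))"
  proof (rule components_open_unique)
    have "disjnt C (interior S)" if "C \<in> components (- (X \<union> S))" for C
      using in_components_subset[OF that] interior_subset by (auto simp: disjnt_def)
    then show "pairwise disjnt (insert (interior S) (components (- (X \<union> S))))"
      using pairwise_disjoint_components[of "- (X \<union> S)"]
      unfolding pairwise_insert by (auto simp: disjnt_sym disjoint_def pairwise_def disjnt_def)
    have "interior S = S - frontier S"
      using clS by (auto simp: frontier_def interior_subset[THEN subsetD])
    then show "\<Union>(insert (interior S) (components (- (X \<union> S)))) = - X"
      unfolding Union_insert Union_components using S(4) by blast
    show "open C \<and> connected C \<and> C \<noteq> {}" if "C \<in> insert (interior S) (components (- (X \<union> S)))" for C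
      using that op open_components[of "- (X \<union> S)" C] in_components_connected[of C]
        in_components_nonempty[of C] S convex_connected[OF convex_interior[OF S(2)]] by auto
  qed
  then show fin: "finite (components (- (X \<union> S)))" using X(3) by simp
  have "interior S \<notin> components (- (X \<union> S))"
    using in_components_subset[of "interior S" "- (X \<union> S)"] S(3) interior_subset[of S] by blast
  then show "Suc (card (components (- (X \<union> S)))) = card (components (- X))"
    using eq fin by simp
qed

section \<open>Simplicial complexes and their Euler sum\<close>

lemma simplex_1_eq_closed_segment:
  assumes "1 simplex S"
  obtains a b where "a \<noteq> b" "S = closed_segment a b"
proof -
  obtain C where C: "card C = 2" "S = convex hull C"
    using assms by (auto simp: simplex_def)
  then obtain a b where "C = {a, b}" "a \<noteq> b" by (auto simp: card_2_iff)
  then show thesis using that C(2) by (simp add: segment_convex_hull)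
qed

lemma rel_interior_full_dim:
  fixes S :: "'a::euclidean_space set"
  assumes "aff_dim S = DIM('a)"
  shows "rel_interior S = interior S" "rel_frontier S = frontier S"
proof -
  have "affine hull S = UNIV" using assms by (simp flip: aff_dim_eq_full)
  then show "rel_interior S = interior S" "rel_frontier S = frontier S"
    by (auto simp: rel_interior_interior rel_frontier_frontier)
qed

lemma simplicial_complex_face_eq:
  assumes T: "simplicial_complex T" and S: "S \<in> T" "\<forall>S'\<in>T. aff_dim S' \<le> aff_dim S"
    and S': "S' \<in> T" "S face_of S'"
  shows "S' = S"
proof (rule ccontr)
  assume "S' \<noteq> S"
  moreover have "convex S'" using T S'(1) convex_simplex unfolding simplicial_complex_def by blast
  ultimately have "aff_dim S < aff_dim S'" using face_of_aff_dim_lt S'(2) by metis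
  then show False using S(2) S'(1) by fastforce
qed

text \<open>Every other simplex meets \<open>S\<close> in a common face, which is proper by
  maximality and so lies in the relative frontier. Conversely, the relative frontier is the union of
  the proper faces, all of which remain in \<open>T - {S}\<close>.\<close>

lemma simplicial_complex_remove_maximal:
  assumes T: "simplicial_complex T" and S: "S \<in> T" "\<forall>S'\<in>T. aff_dim S' \<le> aff_dim S"
  shows "simplicial_complex (T - {S})" and "S \<inter> \<Union>(T - {S}) = rel_frontier S"
proof -
  note top = simplicial_complex_face_eq[OF T S]
  show "simplicial_complex (T - {S})"
    using T top unfolding simplicial_complex_def by blast
  have poly: "polyhedron S" using T S(1) simplex_imp_polyhedron unfolding simplicial_complex_def by blast
  show "S \<inter> \<Union>(T - {S}) = rel_frontier S"
  proof (intro equalityI subsetI)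
    fix x assume "x \<in> S \<inter> \<Union>(T - {S})"
    then obtain S' where S': "S' \<in> T" "S' \<noteq> S" "x \<in> S \<inter> S'" by blast
    have f: "(S \<inter> S') face_of S" "(S' \<inter> S) face_of S'"
      using T S(1) S'(1) unfolding simplicial_complex_def by blast+
    then have "S \<inter> S' \<noteq> S" using top[OF S'(1)] S'(2) by (metis inf_commute)
    then show "x \<in> rel_frontier S" using face_of_subset_rel_frontier[OF f(1)] S'(3) by blast
  next
    fix x assume "x \<in> rel_frontier S"
    then obtain F where "F face_of S" "F \<noteq> S" "x \<in> F"
      unfolding rel_frontier_of_polyhedron_alt[OF poly] by blast
    then show "x \<in> S \<inter> \<Union>(T - {S})"
      using T S(1) face_of_imp_subset unfolding simplicial_complex_def by blast
  qed
qed

text \<open>A finite union of closed convex sets is an ANR, hence locally path connected; this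
  supplies the arcs for the cross-cut argument.\<close>

lemma simplicial_complex_Union:
  assumes "simplicial_complex T"
  shows "compact (\<Union>T)" "locally path_connected (\<Union>T)"
proof -
  have "finite T" "\<And>S. S \<in> T \<Longrightarrow> compact S \<and> closed S \<and> convex S"
    using assms compact_simplex closed_simplex convex_simplex unfolding simplicial_complex_def by blast+
  then show "compact (\<Union>T)" "locally path_connected (\<Union>T)"
    by (auto intro!: compact_Union ANR_imp_locally_path_connected ANR_finite_Union_convex_closed)
qed

text \<open>One signed term per simplex makes the effect of adding a simplex a single summand. The
  empty simplex must be left out: its dimension \<open>-1\<close> becomes \<open>0\<close> under
  \<open>nat\<close>, and it would count as a vertex.\<close>

definition euler_sum :: "'a::euclidean_space set set \<Rightarrow> int" where
  "euler_sum T = (\<Sum>S\<in>T - {{}}. (- 1) ^ nat (aff_dim S))"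

text \<open>Adding a vertex creates a component. Adding an edge either merges two components or, if its
  ends are already joined, cuts a face in two. Adding a triangle fills in a face.\<close>

theorem euler_sum_eq_components:
  fixes T :: "(real^2) set set"
  assumes "simplicial_complex T"
  shows "finite (components (\<Union>T)) \<and> finite (components (- \<Union>T)) \<and>
    euler_sum T = int (card (components (\<Union>T))) - int (card (components (- \<Union>T))) + 1"
  using assms
proof (induction "card T" arbitrary: T rule: less_induct)
  case less
  have fin: "finite T" using less.prems by (simp add: simplicial_complex_def)
  show ?case
  proof (cases "T = {}")
    case True
    \<comment> \<open>This case fixes the constant \<open>1\<close>: the empty union has no
      component and its complement exactly one.\<close>
    have "components (UNIV :: (real^2) set) = {UNIV}" by (simp add: components_eq_sing_iff)
    then show ?thesis using True by (simp add: euler_sum_def)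
  next
    case False
    then have im: "finite (aff_dim ` T)" "aff_dim ` T \<noteq> {}" using fin by auto
    then obtain S where S: "S \<in> T" "aff_dim S = Max (aff_dim ` T)"
      using Max_in by (metis imageE)
    then have max: "\<forall>S'\<in>T. aff_dim S' \<le> aff_dim S" using im by simp
    define T' where "T' = T - {S}"
    define X where "X = \<Union>T'"
    have T': "simplicial_complex T'" and SX: "S \<inter> X = rel_frontier S"
      using simplicial_complex_remove_maximal[OF less.prems S(1) max] by (auto simp: T'_def X_def)
    have "card T' < card T" using fin S(1) unfolding T'_def by (rule card_Diff1_less)
    then have IH: "finite (components X)" "finite (components (- X))"
      "euler_sum T' = int (card (components X)) - int (card (components (- X))) + 1"
      using less.hyps[OF _ T'] by (auto simp: X_def)
    have X: "compact X" "locally path_connected X" "closed X"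
      using simplicial_complex_Union[OF T'] compact_imp_closed by (auto simp: X_def)
    have UT: "\<Union>T = X \<union> S" using S(1) by (auto simp: X_def T'_def)
    obtain n where n: "n simplex S" using less.prems S(1) unfolding simplicial_complex_def by blast
    have dim: "aff_dim S = n" by (rule aff_dim_simplex[OF n])
    have "-1 \<le> n" "n \<le> 2" using simplex_dim_ge[OF n] aff_dim_le_DIM[of S] dim by auto
    have euler: "euler_sum T = euler_sum T' + (- 1) ^ nat n" if "S \<noteq> {}"
    proof -
      have "T - {{}} = insert S (T' - {{}})" using S(1) that by (auto simp: T'_def)
      then show ?thesis using fin by (simp add: euler_sum_def T'_def dim)
    qed
    from \<open>-1 \<le> n\<close> \<open>n \<le> 2\<close> consider "n = -1" | "n = 0" | "n = 1" | "n = 2" by linarith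
    then show ?thesis
    proof cases
      case 1
      then have "S = {}" using n by simp
      then have "T - {{}} = T' - {{}}" by (auto simp: T'_def)
      then show ?thesis using IH UT \<open>S = {}\<close> by (simp add: euler_sum_def)
    next
      case 2
      then obtain v where v: "S = {v}" using n by (auto simp: simplex_zero)
      have "v \<notin> X" using SX v by auto
      then show ?thesis
        using components_Un_point[of X v] X IH UT v euler 2 by simp
    next
      case 3
      then obtain a b where ab: "a \<noteq> b" and Sab: "S = closed_segment a b"
        using n simplex_1_eq_closed_segment by metis
      have "closed_segment a b \<inter> X = {a, b}"
        using SX ab unfolding Sab
        by (auto simp: rel_frontier_def rel_interior_closed_segment open_segment_def)
      from components_Un_segment[OF X(1,2) IH(1,2) ab this] show ?thesis
        using IH(3) UT euler 3 unfolding Sab by simp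
    next
      case 4
      have "interior S \<noteq> {}"
        using rel_interior_full_dim(1)[of S] rel_interior_eq_empty[OF convex_simplex[OF n]] dim 4 by auto
      moreover have "S \<inter> X = frontier S"
        using SX rel_interior_full_dim(2)[of S] dim 4 by simp
      moreover have "S \<noteq> {}" using dim 4 by auto
      ultimately show ?thesis
        using components_Un_convex_body[of X S] X IH compact_simplex[OF n] convex_simplex[OF n] UT euler 4
        by simp
    qed
  qed
qed

section \<open>The frontier as the union of a subcomplex\<close>

text \<open>The tube around the edge avoids every simplex that does not contain the edge. A side of
  it that meets a triangle on the edge cannot leave this triangle, so each side lies in the union or
  misses it. If both lie in it, the open edge is interior; otherwise the whole open edge is
  approached from outside.\<close>

lemma open_segment_frontier_dichotomy:
  fixes T :: "(real^2) set set"
  assumes T: "simplicial_complex T" and ab: "closed_segment a b \<in> T" "a \<noteq> b"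
  shows "open_segment a b \<subseteq> frontier (\<Union>T) \<or> open_segment a b \<subseteq> interior (\<Union>T)"
proof -
  let ?S = "closed_segment a b" and ?K = "\<Union>T"
  have simp_T: "finite T" "\<And>S. S \<in> T \<Longrightarrow> \<exists>n. n simplex S"
    "\<And>F S. S \<in> T \<Longrightarrow> F face_of S \<Longrightarrow> F \<in> T"
    "\<And>S S'. S \<in> T \<Longrightarrow> S' \<in> T \<Longrightarrow> (S \<inter> S') face_of S"
    using T unfolding simplicial_complex_def by blast+
  define P where "P = {t \<in> T. \<not> ?S \<subseteq> t}"
  define X where "X = \<Union>P"
  have "closed X"
    unfolding X_def P_def using simp_T(1,2) closed_simplex by (intro closed_Union) auto
  have "{a} face_of ?S"
    by (simp add: face_of_singleton extreme_point_of_segment)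
  then have "{a} \<in> T" using simp_T(3) ab(1) by blast
  then have aX: "a \<in> X" using ab(2) by (auto simp: X_def P_def)
  \<comment> \<open>A simplex that contains a relative interior point of the edge meets the edge in
    a face that can only be the whole edge.\<close>
  have disj: "open_segment a b \<inter> X = {}"
  proof (rule ccontr)
    assume "open_segment a b \<inter> X \<noteq> {}"
    then obtain y t where y: "y \<in> open_segment a b" "y \<in> t" "t \<in> T" "\<not> ?S \<subseteq> t"
      by (auto simp: X_def P_def)
    have "(?S \<inter> t) \<inter> rel_interior ?S = {}"
      using face_of_disjoint_rel_interior[OF simp_T(4)[OF ab(1) y(3)]] y(4) by blast
    then show False using y ab(2) by (auto simp: rel_interior_closed_segment open_segment_def)
  qed
  have dimS: "aff_dim ?S = 1" using aff_dim_simplex[OF one_simplex_segment[OF ab(2)]] .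
  have side: "M \<subseteq> ?K \<or> M \<inter> ?K = {}" if M: "connected M" "M \<inter> (X \<union> ?S) = {}" for M
  proof (rule disjCI)
    assume "M \<inter> ?K \<noteq> {}"
    then obtain t where t: "t \<in> T" "M \<inter> t \<noteq> {}" by blast
    \<comment> \<open>\<open>M\<close> avoids the edge and all simplices in \<open>P\<close>, so
      \<open>t\<close> contains the edge properly, and by dimension it is a triangle.\<close>
    then have St: "?S \<subseteq> t" "?S \<noteq> t" using M(2) by (auto simp: X_def P_def)
    obtain n where n: "n simplex t" using simp_T(2) t by blast
    have "?S face_of t" using simp_T(4)[OF t(1) ab(1)] St(1) by (simp add: Int_absorb1)
    then have "1 < n"
      using face_of_aff_dim_lt[OF convex_simplex[OF n] _ St(2)] dimS aff_dim_simplex[OF n] by simp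
    moreover have "n \<le> 2" using aff_dim_le_DIM[of t] aff_dim_simplex[OF n] by simp
    ultimately have dimt: "aff_dim t = 2" using aff_dim_simplex[OF n] by simp
    \<comment> \<open>A proper face of \<open>t\<close> either fails to contain the edge, and then
      belongs to \<open>P\<close>, or has dimension at most one and equals the edge.\<close>
    have "frontier t \<subseteq> X \<union> ?S"
    proof
      fix x assume "x \<in> frontier t"
      then have "x \<in> rel_frontier t" using rel_interior_full_dim(2)[of t] dimt by simp
      then obtain F where F: "F face_of t" "F \<noteq> t" "x \<in> F"
        unfolding rel_frontier_of_polyhedron_alt[OF simplex_imp_polyhedron[OF n]] by blast
      have FT: "F \<in> T" using simp_T(3) t F by blast
      show "x \<in> X \<union> ?S"
      proof (cases "?S \<subseteq> F")
        case True
        then have fS: "?S face_of F" using simp_T(4)[OF FT ab(1)] by (simp add: Int_absorb1)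
        have "aff_dim F < 2" using face_of_aff_dim_lt[OF convex_simplex[OF n] F(1,2)] dimt by simp
        then have "?S = F"
          using face_of_aff_dim_lt[OF face_of_imp_convex[OF F(1)] fS] dimS by fastforce
        then show ?thesis using F by blast
      qed (use FT F in \<open>auto simp: X_def P_def\<close>)
    qed
    then have "M - t = {}"
      using connected_Int_frontier[OF M(1) t(2)] M(2) by blast
    then show "M \<subseteq> ?K" using t by blast
  qed
  obtain L R l r where LR:
    "connected L" "l \<in> L" "L \<inter> (X \<union> ?S) = {}" "open_segment a b \<subseteq> closure L"
    "connected R" "r \<in> R" "R \<inter> (X \<union> ?S) = {}" "open_segment a b \<subseteq> closure R"
    "open (L \<union> R \<union> open_segment a b)"
    using segment_sides[OF \<open>closed X\<close> aX ab(2) disj] by metis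
  have segK: "open_segment a b \<subseteq> ?K" using ab(1) by (auto simp: open_segment_def)
  have out: "open_segment a b \<subseteq> frontier ?K" if "M \<inter> ?K = {}" "open_segment a b \<subseteq> closure M" for M
  proof -
    have "closure M \<subseteq> closure (- ?K)" using that by (intro closure_mono) auto
    then show ?thesis using that segK closure_subset by (fastforce simp: frontier_closures)
  qed
  show ?thesis
  proof (cases "L \<subseteq> ?K \<and> R \<subseteq> ?K")
    case True
    then have "open_segment a b \<subseteq> interior ?K"
      using interior_maximal[OF _ LR(9), of ?K] segK by blast
    then show ?thesis ..
  next
    case False
    then show ?thesis using side LR out by metis
  qed
qed

text \<open>Among the simplices through \<open>x\<close>, one of least dimension cannot have
  \<open>x\<close> on a proper face.\<close>

lemma simplicial_complex_carrier:
  assumes T: "simplicial_complex T" and x: "x \<in> \<Union>T"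
  obtains S where "S \<in> T" "x \<in> rel_interior S"
proof -
  define A where "A = {S \<in> T. x \<in> S}"
  have "finite (aff_dim ` A)" "aff_dim ` A \<noteq> {}"
    using T x by (auto simp: A_def simplicial_complex_def)
  then obtain S where S: "S \<in> A" "aff_dim S = Min (aff_dim ` A)"
    using Min_in by (metis imageE)
  then have min: "aff_dim S \<le> aff_dim F" if "F \<in> A" for F
    using that \<open>finite (aff_dim ` A)\<close> by simp
  obtain n where n: "n simplex S" using S T unfolding A_def simplicial_complex_def by blast
  have "x \<notin> rel_frontier S"
  proof
    assume "x \<in> rel_frontier S"
    then obtain F where F: "F face_of S" "F \<noteq> S" "x \<in> F"
      unfolding rel_frontier_of_polyhedron_alt[OF simplex_imp_polyhedron[OF n]] by blast
    have "aff_dim F < aff_dim S" by (rule face_of_aff_dim_lt[OF convex_simplex[OF n] F(1,2)])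
    moreover have "F \<in> A" using T S F unfolding A_def simplicial_complex_def by blast
    ultimately show False using min by fastforce
  qed
  then have "x \<in> rel_interior S"
    using S closure_subset[of S] by (auto simp: rel_frontier_def A_def)
  then show thesis using that S by (auto simp: A_def)
qed

text \<open>A frontier point is carried by a vertex or by an edge, and the dichotomy puts that edge
  into the frontier as a whole. A triangle is excluded because its relative interior is open in the
  plane.\<close>

lemma Union_boundary_complex:
  assumes T: "simplicial_complex T"
  shows "\<Union>(boundary_complex (\<Union>T) T) = frontier (\<Union>T)"
proof
  show "\<Union>(boundary_complex (\<Union>T) T) \<subseteq> frontier (\<Union>T)" by (auto simp: boundary_complex_def)
  show "frontier (\<Union>T) \<subseteq> \<Union>(boundary_complex (\<Union>T) T)"
  proof
    fix x assume x: "x \<in> frontier (\<Union>T)"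
    have "closed (\<Union>T)" using simplicial_complex_Union(1)[OF T] compact_imp_closed by blast
    then have "x \<in> \<Union>T" using x frontier_subset_closed by blast
    then obtain S where S: "S \<in> T" "x \<in> rel_interior S"
      using simplicial_complex_carrier[OF T] by metis
    then have xS: "x \<in> S" using rel_interior_subset by blast
    obtain n where n: "n simplex S" using T S(1) unfolding simplicial_complex_def by blast
    have dim: "aff_dim S = n" by (rule aff_dim_simplex[OF n])
    have "n \<noteq> -1" using n xS by auto
    then consider "n = 0" | "n = 1" | "n = 2"
      using simplex_dim_ge[OF n] aff_dim_le_DIM[of S] dim by fastforce
    then have "S \<subseteq> frontier (\<Union>T)"
    proof cases
      case 1
      then show ?thesis using n xS x by (auto simp: simplex_zero)
    next
      case 2
      then obtain a b where ab: "a \<noteq> b" "S = closed_segment a b"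
        using n simplex_1_eq_closed_segment by metis
      have "x \<in> open_segment a b" using S(2) ab by (simp add: rel_interior_closed_segment)
      then have "open_segment a b \<subseteq> frontier (\<Union>T)"
        using open_segment_frontier_dichotomy[OF T _ ab(1)] S(1) ab(2) x by (auto simp: frontier_def)
      then have "closure (open_segment a b) \<subseteq> frontier (\<Union>T)"
        by (rule closure_minimal) simp
      then show ?thesis using ab by simp
    next
      case 3
      then have "x \<in> interior (\<Union>T)"
        using S rel_interior_full_dim(1)[of S] dim interior_mono[of S "\<Union>T"] by auto
      then show ?thesis using x by (simp add: frontier_def)
    qed
    then show "x \<in> \<Union>(boundary_complex (\<Union>T) T)"
      using S(1) xS by (auto simp: boundary_complex_def)
  qed
qed

lemma simplicial_complex_boundary_complex:
  assumes "simplicial_complex T"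
  shows "simplicial_complex (boundary_complex K T)"
proof -
  have "finite (boundary_complex K T)"
    using assms by (simp add: simplicial_complex_def boundary_complex_def)
  moreover have "F \<subseteq> frontier K" if "F face_of S" "S \<subseteq> frontier K" for F S
    using that face_of_imp_subset by blast
  ultimately show ?thesis
    using assms unfolding simplicial_complex_def boundary_complex_def by blast
qed

section \<open>Counting simplices up to identification\<close>

lemma euler_sum_eq_simplices:
  assumes T: "simplicial_complex T"
  shows "euler_sum T = int (card (simplices 0 T)) - int (card (simplices 1 T)) + int (card (simplices 2 T))"
proof -
  have fin: "finite (simplices n T)" for n
    using T by (simp add: simplices_def simplicial_complex_def)
  have eq: "T - {{}} = simplices 0 T \<union> simplices 1 T \<union> simplices 2 T"
  proof (intro equalityI subsetI)
    fix S assume S: "S \<in> T - {{}}"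
    then obtain n where n: "n simplex S" using T unfolding simplicial_complex_def by blast
    have "n \<noteq> -1" using n S by auto
    then have "n = 0 \<or> n = 1 \<or> n = 2"
      using simplex_dim_ge[OF n] aff_dim_le_DIM[of S] aff_dim_simplex[OF n] by fastforce
    then show "S \<in> simplices 0 T \<union> simplices 1 T \<union> simplices 2 T"
      using n S by (auto simp: simplices_def)
  qed (auto simp: simplices_def)
  have disj: "simplices m T \<inter> simplices n T = {}" if "m \<noteq> n" for m n
    using that by (auto simp: simplices_def dest!: aff_dim_simplex)
  have sums: "(\<Sum>S\<in>simplices n T. (- 1) ^ nat (aff_dim S)) = int (card (simplices n T)) * (- 1) ^ nat n" for n
  proof -
    have "(\<Sum>S\<in>simplices n T. (- 1) ^ nat (aff_dim S)) = (\<Sum>S\<in>simplices n T. (- 1) ^ nat n :: int)"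
      by (rule sum.cong) (auto simp: simplices_def aff_dim_simplex)
    then show ?thesis by simp
  qed
  have "(simplices 0 T \<union> simplices 1 T) \<inter> simplices 2 T = {}"
    using disj[of 0 2] disj[of 1 2] by auto
  then show ?thesis
    unfolding euler_sum_def eq using disj[of 0 1] fin
    by (simp add: sum.union_disjoint sums)
qed

text \<open>A simplex off the boundary is related only to itself, and classes of boundary simplices
  stay inside the boundary, so the quotient splits into two disjoint parts. The identifications thus
  enter both Euler characteristics through the same boundary terms.\<close>

lemma num_simplices_identified:
  assumes "finite T"
  shows "num_simplices n T (identified K T vname ename) =
    num_simplices n (boundary_complex K T) (identified K T vname ename) +
    card (simplices n T - boundary_complex K T)"
proof -
  define R where "R = identified K T vname ename"
  let ?B = "simplices n (boundary_complex K T)" and ?I = "simplices n T - boundary_complex K T"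
  have split: "simplices n T = ?B \<union> ?I"
    by (auto simp: simplices_def boundary_complex_def)
  have int: "R `` {S} = {S}" if "S \<in> ?I" for S
    using that by (auto simp: R_def identified_def simplices_def)
  have bdry: "R `` {S} \<subseteq> boundary_complex K T" if "S \<in> ?B" for S
    using that by (auto simp: R_def identified_def simplices_def)
  have "?I // R = (\<lambda>S. {S}) ` ?I"
    using int by (auto simp: quotient_def)
  then have cI: "card (?I // R) = card ?I"
    by (simp add: card_image)
  have "C \<subseteq> boundary_complex K T" if "C \<in> ?B // R" for C
    using that bdry by (auto elim!: quotientE)
  moreover have "C \<inter> boundary_complex K T = {} \<and> C \<noteq> {}" if "C \<in> ?I // R" for C
  proof -
    from that obtain S where "S \<in> ?I" "C = R `` {S}" by (auto elim!: quotientE)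
    then show ?thesis using int by auto
  qed
  ultimately have "(?B // R) \<inter> (?I // R) = {}" by blast
  moreover have "finite (?B // R)" "finite (?I // R)"
    using assms by (auto simp: simplices_def boundary_complex_def quotient_def)
  ultimately have "card ((?B // R) \<union> (?I // R)) = card (?B // R) + card (?I // R)"
    by (intro card_Un_disjoint)
  moreover have "simplices n T // R = (?B // R) \<union> (?I // R)"
    by (subst split) (auto simp: quotient_def)
  ultimately show ?thesis
    using cI by (simp add: num_simplices_def R_def)
qed

theorem theorem2p1:
  fixes K :: "(real^2) set" and T :: "(real^2) set set"
    and vname :: "real^2 \<Rightarrow> 'v" and ename :: "(real^2) set \<Rightarrow> 'e"
    and tail head :: "(real^2) set \<Rightarrow> real^2"
  assumes "triangulated_polygon K T"
    and "boundary_labelling K T vname ename tail head"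
  shows "euler_char_polygon K T vname ename = euler_char_boundary K T vname ename + 1"
proof -
  have T: "simplicial_complex T" and UT: "\<Union>T = K" and hom: "K homeomorphic cball (0::real^2) 1"
    using assms(1) by (auto simp: triangulated_polygon_def)
  let ?R = "identified K T vname ename" and ?T0 = "boundary_complex K T"
  have T0: "simplicial_complex ?T0" by (rule simplicial_complex_boundary_complex[OF T])
  have fin: "finite T" using T by (simp add: simplicial_complex_def)
  have K: "compact K" "closed K"
    using simplicial_complex_Union(1)[OF T] UT compact_imp_closed by auto
  have "connected K" using homeomorphic_connectedness[OF hom] by simp
  have "K \<noteq> {}" using homeomorphic_empty[of "cball (0::real^2) 1"] hom by force
  have "connected (- K)"
    using connected_complement_homeomorphic_convex_compact[OF hom] by simp
  have "- K \<noteq> {}" using compact_imp_bounded[OF K(1)] not_bounded_UNIV by (metis Compl_empty_eq double_complement)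
  \<comment> \<open>Invariance of domain lets the homeomorphism with the disc restrict to the
    interiors, so that \<open>interior K\<close> inherits connectedness from the open ball.\<close>
  have "interior K homeomorphic interior (cball (0::real^2) 1)"
    by (rule homeomorphic_interiors_same_dimension[OF hom]) simp
  then have int: "connected (interior K)" "interior K \<noteq> {}"
    using homeomorphic_connectedness[of "interior K"] homeomorphic_empty(1)[of "ball (0::real^2) 1"] by auto
  have cK: "components K = {K}" "components (- K) = {- K}"
    using \<open>connected K\<close> \<open>K \<noteq> {}\<close> \<open>connected (- K)\<close> \<open>- K \<noteq> {}\<close> by (simp_all add: components_eq_sing_iff)
  \<comment> \<open>Unicoherence of the plane: the closures of \<open>K\<close> and
    \<open>- K\<close> are connected and cover the plane, so their intersection is
    connected.\<close>
  have "connected (frontier K)"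
    using \<open>connected K\<close> \<open>connected (- K)\<close> by (rule connected_frontier_simple)
  moreover have "frontier K \<noteq> {}" using \<open>K \<noteq> {}\<close> \<open>- K \<noteq> {}\<close> frontier_eq_empty[of K] by auto
  ultimately have cF: "components (frontier K) = {frontier K}" by (simp add: components_eq_sing_iff)
  have cF': "components (- frontier K) = {interior K, - K}"
  proof (rule components_open_unique)
    show "pairwise disjnt {interior K, - K}"
      using interior_subset[of K] by (auto simp: pairwise_insert disjnt_def)
    show "\<Union>{interior K, - K} = - frontier K"
      using K(2) interior_subset[of K] by (auto simp: frontier_def)
  qed (use int K(2) \<open>connected (- K)\<close> \<open>- K \<noteq> {}\<close> in \<open>auto simp: open_Compl\<close>)
  have "interior K \<noteq> - K" using int(2) interior_subset[of K] by blast
  then have chi0: "euler_sum ?T0 = 0"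
    using euler_sum_eq_components[OF T0] Union_boundary_complex[OF T] UT cF cF' by simp
  have chi: "euler_sum T = 1"
    using euler_sum_eq_components[OF T] UT cK by simp
  \<comment> \<open>\<open>euler_sum\<close> has a triangle term and
    \<open>euler_char_boundary\<close> has none, so this term has to vanish. A triangle has interior
    points, and these would be interior to \<open>K\<close>.\<close>
  have no2: "simplices 2 ?T0 = {}"
  proof -
    have False if S: "2 simplex S" "S \<subseteq> frontier K" for S
    proof -
      have "aff_dim S = 2" by (rule aff_dim_simplex[OF S(1)])
      then have "interior S \<noteq> {}"
        using rel_interior_full_dim(1)[of S] rel_interior_eq_empty[OF convex_simplex[OF S(1)]] by auto
      moreover have "interior S \<subseteq> interior K"
        using S(2) frontier_subset_closed[OF K(2)] by (intro interior_mono) blast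
      ultimately show False using S(2) interior_subset[of S] by (auto simp: frontier_def)
    qed
    then show ?thesis by (auto simp: simplices_def boundary_complex_def)
  qed
  have cards: "card (simplices n T) = card (simplices n ?T0) + card (simplices n T - ?T0)" for n
  proof -
    have "simplices n T = simplices n ?T0 \<union> (simplices n T - ?T0)"
      "simplices n ?T0 \<inter> (simplices n T - ?T0) = {}"
      by (auto simp: simplices_def boundary_complex_def)
    moreover have "finite (simplices n T)" using fin by (simp add: simplices_def)
    ultimately show ?thesis by (metis card_Un_disjoint finite_Un)
  qed
  have "num_simplices 2 ?T0 ?R = 0" by (simp add: num_simplices_def no2)
  \<comment> \<open>The difference of \<open>chi\<close> and \<open>chi0\<close> says that the
    alternating count of simplices off the boundary is \<open>1\<close>; the boundary classes appear
    on both sides of the goal and cancel.\<close>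
  then show ?thesis
    using chi chi0 cards[of 0] cards[of 1] cards[of 2] no2
    unfolding euler_char_polygon_def euler_char_boundary_def Let_def
      num_simplices_identified[OF fin] euler_sum_eq_simplices[OF T] euler_sum_eq_simplices[OF T0]
    by simp
qed

end
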